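(* Let $\mathcal H_{A_1}=\mathcal H_{A_2}=\mathcal H_{A_3}=\mathcal H_E=\mathbb C^2$ and $\mathcal H_B=\mathbb C^8$, with innocent input states $\phi_{0,1}=\phi_{0,2}=\phi_{0,3}=|0\rangle\langle0|$. Let $V=Z\otimes Z\otimes Z$ with $Z$ the Pauli-$Z$ operator, $\Pi_\pm=\frac{\mathbb I\pm V}{2}$, let $W=|0\rangle_E\otimes\Pi_++|1\rangle_E\otimes\Pi_-$, and let $\mathcal N_{A_{[3]}\to BE}(\rho)=W\rho W^\dagger$. Consider this channel as a multiple-access channel with a helper, where transmitter 1 knows $M_1$, transmitter 2 knows $M_2$, and transmitter 3 knows both $M_1$ and $M_2$. Then $\{(R_1,R_2):0\le R_1<1,\ 0\le R_2<1\}$ is an achievable covert rate region, i.e. it is contained in the covert capacity region of this channel.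
   Context: Logarithms are base 2. $\mathcal D(\mathcal H)$ is the set of density operators on $\mathcal H$. $W$ is an isometry from $\mathcal H_{A_1}\otimes\mathcal H_{A_2}\otimes\mathcal H_{A_3}=\mathbb C^8$ to $\mathcal H_E\otimes\mathcal H_B$; $B$ goes to the legitimate receiver and $E$ to the warden. Let $\rho_0=\mathrm{Tr}_B\,\mathcal N_{A_{[3]}\to BE}(\phi_{0,1}\otimes\phi_{0,2}\otimes\phi_{0,3})$. A $(2^{nR_1},2^{nR_2},n)$ code consists of message sets $\mathcal M_s=\{1,\dots,\lfloor2^{nR_s}\rfloor\}$ (messages independent and uniform), encoders $m_1\mapsto\rho_{A_1^n}\in\mathcal D(\mathcal H_{A_1}^{\otimes n})$, $m_2\mapsto\rho_{A_2^n}\in\mathcal D(\mathcal H_{A_2}^{\otimes n})$, $(m_1,m_2)\mapsto\rho_{A_3^n}\in\mathcal D(\mathcal H_{A_3}^{\otimes n})$, and a decoding POVM on $\mathcal H_B^{\otimes n}$; the channel $\mathcal N^{\otimes n}$ is applied to the product of the encoder outputs. A pair $(R_1,R_2)$ is achievable if there is a sequence of codes with average error probability tending to $0$ and $\lim_{n\to\infty}\|\tau_{E^n}-\rho_0^{\otimes n}\|_1=0$, where $\tau_{E^n}$ is the warden's output state averaged over the messages. The covert capacity region is the closure of the set of achievable pairs. *)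

theory Defs
  imports
    "HOL-Analysis.Analysis"
    "Jordan_Normal_Form.Schur_Decomposition"
begin

section \<open>Operators on finite-dimensional Hilbert spaces\<close>

text \<open>A linear map from \<open>\<complex>\<^sup>c\<close> to \<open>\<complex>\<^sup>r\<close> is a matrix in \<open>carrier_mat r c\<close>.
  The basis vector \<open>|i\<rangle> \<otimes> |j\<rangle>\<close> of \<open>\<complex>\<^sup>a \<otimes> \<complex>\<^sup>b\<close> has number \<open>i * b + j\<close>,
  and products of more factors associate to the right.\<close>

definition tensor_mat :: "complex mat \<Rightarrow> complex mat \<Rightarrow> complex mat" (infixr \<open>\<otimes>\<^sub>m\<close> 75) where
  "A \<otimes>\<^sub>m B = mat (dim_row A * dim_row B) (dim_col A * dim_col B)
     (\<lambda>(i, j). A $$ (i div dim_row B, j div dim_col B) * B $$ (i mod dim_row B, j mod dim_col B))"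

definition mat_trace :: "complex mat \<Rightarrow> complex" where
  "mat_trace A = (\<Sum>i<dim_row A. A $$ (i, i))"

definition psd_mat :: "nat \<Rightarrow> complex mat \<Rightarrow> bool" where
  "psd_mat d A \<longleftrightarrow> A \<in> carrier_mat d d \<and> mat_adjoint A = A \<and>
     (\<forall>v \<in> carrier_vec d. 0 \<le> Re ((A *\<^sub>v v) \<bullet>c v))"

definition density_operator :: "nat \<Rightarrow> complex mat \<Rightarrow> bool" where
  "density_operator d \<rho> \<longleftrightarrow> psd_mat d \<rho> \<and> mat_trace \<rho> = 1"

definition psd_sqrt :: "complex mat \<Rightarrow> complex mat" where
  "psd_sqrt A = (THE P. psd_mat (dim_row A) P \<and> P * P = A)"

definition trace_norm :: "complex mat \<Rightarrow> real" where
  "trace_norm A = Re (mat_trace (psd_sqrt (mat_adjoint A * A)))"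

definition partial_trace_fst :: "nat \<Rightarrow> nat \<Rightarrow> complex mat \<Rightarrow> complex mat" where
  "partial_trace_fst a b \<rho> = mat b b (\<lambda>(i, j). \<Sum>k<a. \<rho> $$ (k * b + i, k * b + j))"

definition partial_trace_snd :: "nat \<Rightarrow> nat \<Rightarrow> complex mat \<Rightarrow> complex mat" where
  "partial_trace_snd a b \<rho> = mat a a (\<lambda>(i, j). \<Sum>k<b. \<rho> $$ (i * b + k, j * b + k))"

definition povm :: "nat \<Rightarrow> 'i set \<Rightarrow> ('i \<Rightarrow> complex mat) \<Rightarrow> bool" where
  "povm d I D \<longleftrightarrow> (\<forall>i\<in>I. psd_mat d (D i)) \<and>
     mat d d (\<lambda>(r, c). \<Sum>i\<in>I. D i $$ (r, c)) = 1\<^sub>m d"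

text \<open>A basis vector of \<open>(\<complex>\<^sup>d)\<^sup>\<otimes>\<^sup>n\<close> is numbered by \<open>i < d ^ n\<close>; the base-\<open>d\<close> digit
  of \<open>i\<close> at place \<open>k\<close> is its label in the \<open>k\<close>-th tensor factor.\<close>

definition digit :: "nat \<Rightarrow> nat \<Rightarrow> nat \<Rightarrow> nat" where
  "digit d k i = i div d ^ k mod d"

definition tensor_power :: "complex mat \<Rightarrow> nat \<Rightarrow> complex mat" where
  "tensor_power A n = mat (dim_row A ^ n) (dim_col A ^ n)
     (\<lambda>(i, j). \<Prod>k<n. A $$ (digit (dim_row A) k i, digit (dim_col A) k j))"


section \<open>Covert communication over a multiple-access channel with a helper\<close>

text \<open>The channel is \<open>\<rho> \<mapsto> W \<rho> W\<^sup>\<dagger>\<close> for an isometry \<open>W\<close> from three qubits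
  \<open>A\<^sub>1 \<otimes> A\<^sub>2 \<otimes> A\<^sub>3\<close> to \<open>E \<otimes> B\<close>, with \<open>dE\<close> and \<open>dB\<close> the dimensions of \<open>E\<close> and \<open>B\<close>.

  The matrix below is \<open>W\<^sup>\<otimes>\<^sup>n\<close> with its legs regrouped, from \<open>(A\<^sub>1 \<otimes> A\<^sub>2 \<otimes> A\<^sub>3)\<^sup>\<otimes>\<^sup>n\<close>
  to \<open>A\<^sub>1\<^sup>\<otimes>\<^sup>n \<otimes> A\<^sub>2\<^sup>\<otimes>\<^sup>n \<otimes> A\<^sub>3\<^sup>\<otimes>\<^sup>n\<close> on the input side and from \<open>(E \<otimes> B)\<^sup>\<otimes>\<^sup>n\<close> to
  \<open>E\<^sup>\<otimes>\<^sup>n \<otimes> B\<^sup>\<otimes>\<^sup>n\<close> on the output side.\<close>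

definition isometry_power :: "nat \<Rightarrow> nat \<Rightarrow> complex mat \<Rightarrow> nat \<Rightarrow> complex mat" where
  "isometry_power dE dB W n = mat (dE ^ n * dB ^ n) (2 ^ n * (2 ^ n * 2 ^ n))
     (\<lambda>(r, c).
        let e = r div dB ^ n; b = r mod dB ^ n;
            x1 = c div (2 ^ n * 2 ^ n); x2 = c div 2 ^ n mod 2 ^ n; x3 = c mod 2 ^ n
        in \<Prod>k<n. W $$ (digit dE k e * dB + digit dB k b,
                         digit 2 k x1 * (2 * 2) + digit 2 k x2 * 2 + digit 2 k x3))"

record helper_code =
  enc1 :: "nat \<Rightarrow> complex mat"
  enc2 :: "nat \<Rightarrow> complex mat"
  enc3 :: "nat \<Rightarrow> nat \<Rightarrow> complex mat"
  dec :: "nat \<times> nat \<Rightarrow> complex mat"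

definition messages :: "nat \<Rightarrow> real \<Rightarrow> nat set" where
  "messages n R = {1..nat \<lfloor>2 powr (real n * R)\<rfloor>}"

definition is_helper_code :: "nat \<Rightarrow> real \<Rightarrow> real \<Rightarrow> nat \<Rightarrow> helper_code \<Rightarrow> bool" where
  "is_helper_code dB R1 R2 n C \<longleftrightarrow>
     (\<forall>m1 \<in> messages n R1. density_operator (2 ^ n) (enc1 C m1)) \<and>
     (\<forall>m2 \<in> messages n R2. density_operator (2 ^ n) (enc2 C m2)) \<and>
     (\<forall>m1 \<in> messages n R1. \<forall>m2 \<in> messages n R2. density_operator (2 ^ n) (enc3 C m1 m2)) \<and>
     povm (dB ^ n) (messages n R1 \<times> messages n R2) (dec C)"

definition channel_output ::
  "nat \<Rightarrow> nat \<Rightarrow> complex mat \<Rightarrow> nat \<Rightarrow> helper_code \<Rightarrow> nat \<Rightarrow> nat \<Rightarrow> complex mat" where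
  "channel_output dE dB W n C m1 m2 =
     isometry_power dE dB W n * (enc1 C m1 \<otimes>\<^sub>m enc2 C m2 \<otimes>\<^sub>m enc3 C m1 m2)
       * mat_adjoint (isometry_power dE dB W n)"

definition receiver_state ::
  "nat \<Rightarrow> nat \<Rightarrow> complex mat \<Rightarrow> nat \<Rightarrow> helper_code \<Rightarrow> nat \<Rightarrow> nat \<Rightarrow> complex mat" where
  "receiver_state dE dB W n C m1 m2 =
     partial_trace_fst (dE ^ n) (dB ^ n) (channel_output dE dB W n C m1 m2)"

definition warden_state ::
  "nat \<Rightarrow> nat \<Rightarrow> complex mat \<Rightarrow> nat \<Rightarrow> helper_code \<Rightarrow> nat \<Rightarrow> nat \<Rightarrow> complex mat" where
  "warden_state dE dB W n C m1 m2 =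
     partial_trace_snd (dE ^ n) (dB ^ n) (channel_output dE dB W n C m1 m2)"

definition average_error ::
  "nat \<Rightarrow> nat \<Rightarrow> complex mat \<Rightarrow> real \<Rightarrow> real \<Rightarrow> nat \<Rightarrow> helper_code \<Rightarrow> real" where
  "average_error dE dB W R1 R2 n C =
     (\<Sum>m1 \<in> messages n R1. \<Sum>m2 \<in> messages n R2.
        1 - Re (mat_trace (dec C (m1, m2) * receiver_state dE dB W n C m1 m2)))
     / (real (card (messages n R1)) * real (card (messages n R2)))"

definition average_warden_state ::
  "nat \<Rightarrow> nat \<Rightarrow> complex mat \<Rightarrow> real \<Rightarrow> real \<Rightarrow> nat \<Rightarrow> helper_code \<Rightarrow> complex mat" where
  "average_warden_state dE dB W R1 R2 n C = mat (dE ^ n) (dE ^ n) (\<lambda>(i, j).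
     (\<Sum>m1 \<in> messages n R1. \<Sum>m2 \<in> messages n R2. warden_state dE dB W n C m1 m2 $$ (i, j))
     / (of_nat (card (messages n R1)) * of_nat (card (messages n R2))))"

definition innocent_warden_state ::
  "nat \<Rightarrow> nat \<Rightarrow> complex mat \<Rightarrow> complex mat \<Rightarrow> complex mat \<Rightarrow> complex mat \<Rightarrow> complex mat" where
  "innocent_warden_state dE dB W \<phi>1 \<phi>2 \<phi>3 =
     partial_trace_snd dE dB (W * (\<phi>1 \<otimes>\<^sub>m \<phi>2 \<otimes>\<^sub>m \<phi>3) * mat_adjoint W)"

definition covertly_achievable ::
  "nat \<Rightarrow> nat \<Rightarrow> complex mat \<Rightarrow> complex mat \<Rightarrow> complex mat \<Rightarrow> complex mat \<Rightarrow> real \<times> real \<Rightarrow> bool" where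
  "covertly_achievable dE dB W \<phi>1 \<phi>2 \<phi>3 = (\<lambda>(R1, R2).
     0 \<le> R1 \<and> 0 \<le> R2 \<and>
     (\<exists>C :: nat \<Rightarrow> helper_code.
        (\<forall>n\<ge>1. is_helper_code dB R1 R2 n (C n)) \<and>
        (\<lambda>n. average_error dE dB W R1 R2 n (C n)) \<longlonglongrightarrow> 0 \<and>
        (\<lambda>n. trace_norm (average_warden_state dE dB W R1 R2 n (C n)
               - tensor_power (innocent_warden_state dE dB W \<phi>1 \<phi>2 \<phi>3) n)) \<longlonglongrightarrow> 0))"

definition covert_capacity_region ::
  "nat \<Rightarrow> nat \<Rightarrow> complex mat \<Rightarrow> complex mat \<Rightarrow> complex mat \<Rightarrow> complex mat \<Rightarrow> (real \<times> real) set" where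
  "covert_capacity_region dE dB W \<phi>1 \<phi>2 \<phi>3 =
     closure {R. covertly_achievable dE dB W \<phi>1 \<phi>2 \<phi>3 R}"


section \<open>The parity channel\<close>

definition ket0 :: "complex mat" where
  "ket0 = mat_of_rows_list 1 [[1], [0]]"

definition ket1 :: "complex mat" where
  "ket1 = mat_of_rows_list 1 [[0], [1]]"

definition pauli_Z :: "complex mat" where
  "pauli_Z = mat_of_rows_list 2 [[1, 0], [0, - 1]]"

definition parity_V :: "complex mat" where
  "parity_V = pauli_Z \<otimes>\<^sub>m pauli_Z \<otimes>\<^sub>m pauli_Z"

definition Pi_plus :: "complex mat" where
  "Pi_plus = (1 / 2) \<cdot>\<^sub>m (1\<^sub>m 8 + parity_V)"

definition Pi_minus :: "complex mat" where
  "Pi_minus = (1 / 2) \<cdot>\<^sub>m (1\<^sub>m 8 - parity_V)"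

definition parity_W :: "complex mat" where
  "parity_W = ket0 \<otimes>\<^sub>m Pi_plus + ket1 \<otimes>\<^sub>m Pi_minus"

definition phi0 :: "complex mat" where
  "phi0 = ket0 * mat_adjoint ket0"

end

theory Submission
  imports Defs
begin

text \<open>The first two transmitters send their messages uncoded, as the binary digits of a basis
  vector, and the helper sends the bitwise sum of the two words. Every channel use then has an
  input of even parity, on which \<open>W\<close> acts as \<open>|0\<rangle> \<otimes> I\<close>: the warden's state is exactly the
  innocent one and the receiver reads both words without error, so the error probability and the
  trace distance vanish for every block length.\<close>

section \<open>Digits\<close>

text \<open>Inverse to taking the digits of a number below \<open>d ^ n\<close>. It lets a word be
  specified symbol by symbol, one symbol per channel use.\<close>

definition of_digits :: "nat \<Rightarrow> nat \<Rightarrow> (nat \<Rightarrow> nat) \<Rightarrow> nat" where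
  "of_digits d n f = (\<Sum>k<n. f k * d ^ k)"

lemma digit_less: "0 < d \<Longrightarrow> digit d k i < d"
  by (simp add: digit_def)

lemma digit_zero [simp]: "digit d k 0 = 0"
  by (simp add: digit_def)

lemma of_digits_less:
  assumes "\<And>k. k < n \<Longrightarrow> f k < d"
  shows "of_digits d n f < d ^ n"
  using assms
proof (induction n)
  case (Suc n)
  have "of_digits d (Suc n) f = of_digits d n f + f n * d ^ n"
    by (simp add: of_digits_def)
  also have "\<dots> < (f n + 1) * d ^ n"
    using Suc by simp
  also have "\<dots> \<le> d * d ^ n"
    using Suc.prems[of n] by (intro mult_le_mono1) simp
  finally show ?case by simp
qed (simp add: of_digits_def)

lemma digit_of_digits:
  assumes "\<And>k. k < n \<Longrightarrow> f k < d" "k < n"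
  shows "digit d k (of_digits d n f) = f k"
  using assms
proof (induction n)
  case (Suc n)
  have split: "of_digits d (Suc n) f = of_digits d n f + f n * d ^ n"
    by (simp add: of_digits_def)
  have low: "of_digits d n f < d ^ n"
    using Suc.prems(1) by (intro of_digits_less) simp
  show ?case
  proof (cases "k = n")
    case True
    with low Suc.prems(1)[of n] show ?thesis
      by (simp add: split digit_def)
  next
    case False
    with Suc.prems(2) have kn: "k < n" by simp
    \<comment> \<open>With \<open>n = k + Suc m\<close> the leading term is a multiple of
      \<open>d ^ (k + 1)\<close>, so it cannot change the digit at place \<open>k\<close>.\<close>
    define m where "m = n - Suc k"
    with kn have m: "n = k + Suc m" by simp
    have "0 < d" using Suc.prems(1)[of n] by simp
    moreover have "of_digits d (Suc n) f = of_digits d n f + (f n * d ^ m * d) * d ^ k"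
      unfolding split by (simp add: m power_add algebra_simps)
    ultimately have "digit d k (of_digits d (Suc n) f) = digit d k (of_digits d n f)"
      by (simp only: digit_def) simp
    with Suc kn show ?thesis by simp
  qed
qed simp

lemma of_digits_digit:
  assumes "i < d ^ n"
  shows "of_digits d n (\<lambda>k. digit d k i) = i"
  using assms
proof (induction n arbitrary: i)
  case (Suc n)
  have "0 < d" using Suc.prems by (cases d) auto
  \<comment> \<open>Since \<open>d ^ n\<close> is a multiple of \<open>d ^ (k + 1)\<close> for
    \<open>k < n\<close>, reduction modulo \<open>d ^ n\<close> keeps the low digits, and the
    induction hypothesis applies to the residue.\<close>
  have mod: "digit d k i = digit d k (i mod d ^ n)" if "k < n" for k
  proof -
    define m where "m = n - Suc k"
    with that have m: "n = k + Suc m" by simp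
    have "d ^ n = d ^ k * (d * d ^ m)" by (simp add: m power_add)
    then have "i mod d ^ n div d ^ k = i div d ^ k mod (d * d ^ m)"
      using \<open>0 < d\<close> by (simp add: mod_mult2_eq[of i "d ^ k" "d * d ^ m"])
    then show ?thesis by (simp add: digit_def mod_mod_cancel)
  qed
  have "of_digits d (Suc n) (\<lambda>k. digit d k i)
      = of_digits d n (\<lambda>k. digit d k (i mod d ^ n)) + digit d n i * d ^ n"
    using mod by (simp add: of_digits_def)
  also have "\<dots> = i mod d ^ n + i div d ^ n * d ^ n"
    using Suc \<open>0 < d\<close> by (simp add: digit_def less_mult_imp_div_less)
  also have "\<dots> = i"
    by (rule mod_div_mult_eq)
  finally show ?case .
qed (simp add: of_digits_def)

text \<open>Reduces equality of basis labels of an n-fold tensor power to equality in each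
  factor.\<close>

lemma digits_eqI:
  assumes "i < d ^ n" "j < d ^ n" "\<And>k. k < n \<Longrightarrow> digit d k i = digit d k j"
  shows "i = j"
proof -
  have "of_digits d n (\<lambda>k. digit d k i) = of_digits d n (\<lambda>k. digit d k j)"
    using assms(3) by (simp add: of_digits_def)
  with assms(1,2) show ?thesis by (simp add: of_digits_digit)
qed

section \<open>Projectors on basis vectors\<close>

text \<open>The projector |i><i|, or the zero matrix if i is out of range. Every state in the proof
  has this form, so claims about density matrices become claims about indices.\<close>

definition basis_proj :: "nat \<Rightarrow> nat \<Rightarrow> complex mat" where
  "basis_proj d i = mat d d (\<lambda>(r, c). of_bool (r = i \<and> c = i))"

lemma basis_proj_dim [simp]:
  "dim_row (basis_proj d i) = d" "dim_col (basis_proj d i) = d"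
  by (simp_all add: basis_proj_def)

lemma basis_proj_carrier [simp]: "basis_proj d i \<in> carrier_mat d d"
  by (simp add: basis_proj_def)

lemma dim_mat_adjoint [simp]:
  "dim_row (mat_adjoint A) = dim_col A" "dim_col (mat_adjoint A) = dim_row A"
  by (simp_all add: mat_adjoint_def)

lemma index_mat_adjoint [simp]:
  "i < dim_col A \<Longrightarrow> j < dim_row A \<Longrightarrow> mat_adjoint A $$ (i, j) = cnj (A $$ (j, i))"
  by (simp add: mat_adjoint_def mat_of_rows_def)

text \<open>The quadratic form of a diagonal matrix is the sum of the \<open>p i\<close> weighted by
  |v_i|^2. This covers the encoder states, the decoding operators and the zero matrix.\<close>

lemma psd_diag:
  assumes "\<And>i. i < d \<Longrightarrow> p i \<ge> (0::real)"
  shows "psd_mat d (mat d d (\<lambda>(r, c). if r = c then complex_of_real (p r) else 0))"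
proof -
  let ?A = "mat d d (\<lambda>(r, c). if r = c then complex_of_real (p r) else 0)"
  have "0 \<le> Re ((?A *\<^sub>v v) \<bullet>c v)" if v: "v \<in> carrier_vec d" for v
  proof -
    have "(?A *\<^sub>v v) $ i = complex_of_real (p i) * v $ i" if "i < d" for i
    proof -
      have "(?A *\<^sub>v v) $ i = (\<Sum>j = 0..<d. ?A $$ (i, j) * v $ j)"
        using that v by (simp add: scalar_prod_def)
      also have "\<dots> = (\<Sum>j = 0..<d. if i = j then p j * v $ j else 0)"
        using that by (intro sum.cong) auto
      also have "\<dots> = p i * v $ i"
        using that by simp
      finally show ?thesis .
    qed
    then have "(?A *\<^sub>v v) \<bullet>c v = (\<Sum>i = 0..<d. complex_of_real (p i) * v $ i * cnj (v $ i))"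
      using v by (simp add: scalar_prod_def)
    also have "\<dots> = (\<Sum>i = 0..<d. complex_of_real (p i * (cmod (v $ i))\<^sup>2))"
      by (simp only: mult.assoc of_real_mult complex_norm_square)
    also have "Re \<dots> = (\<Sum>i = 0..<d. p i * (cmod (v $ i))\<^sup>2)"
      by simp
    also have "0 \<le> \<dots>"
      using assms by (intro sum_nonneg) simp
    finally show ?thesis .
  qed
  then show ?thesis
    by (auto simp: psd_mat_def intro!: eq_matI)
qed

lemma density_basis_proj:
  assumes "i < d"
  shows "density_operator d (basis_proj d i)"
proof -
  have eq: "basis_proj d i
      = mat d d (\<lambda>(r, c). if r = c then complex_of_real (of_bool (r = i)) else 0)"
    by (auto simp: basis_proj_def intro!: eq_matI)
  have "psd_mat d (basis_proj d i)"
    unfolding eq by (rule psd_diag) simp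
  moreover have "mat_trace (basis_proj d i) = 1"
    using assms by (simp add: mat_trace_def basis_proj_def of_bool_def)
  ultimately show ?thesis by (simp add: density_operator_def)
qed

lemma div_mod_eq_iff:
  fixes r :: nat
  assumes "j < b"
  shows "r div b = i \<and> r mod b = j \<longleftrightarrow> r = i * b + j"
proof
  show "r = i * b + j" if "r div b = i \<and> r mod b = j"
    using that div_mult_mod_eq[of r b] by simp
qed (use assms in simp)

lemma tensor_basis_proj:
  assumes "j < b"
  shows "basis_proj a i \<otimes>\<^sub>m basis_proj b j = basis_proj (a * b) (i * b + j)"
proof (rule eq_matI)
  fix r c assume "r < dim_row (basis_proj (a * b) (i * b + j))"
    "c < dim_col (basis_proj (a * b) (i * b + j))"
  then have rc: "r < a * b" "c < a * b" by simp_all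
  then have "0 < b" by (cases b) auto
  with rc show "(basis_proj a i \<otimes>\<^sub>m basis_proj b j) $$ (r, c)
      = basis_proj (a * b) (i * b + j) $$ (r, c)"
    using div_mod_eq_iff[OF assms, of r i] div_mod_eq_iff[OF assms, of c i]
    by (auto simp: tensor_mat_def basis_proj_def less_mult_imp_div_less)
qed (simp_all add: tensor_mat_def)

text \<open>Here U |i> = |j>, so conjugating |i><i| by U gives |j><j|. Only column i enters, hence
  the n-fold isometry has to be computed on code words alone.\<close>

lemma conj_basis_proj:
  assumes U: "U \<in> carrier_mat m d" and "i < d"
    and col: "\<And>r. r < m \<Longrightarrow> U $$ (r, i) = of_bool (r = j)"
  shows "U * basis_proj d i * mat_adjoint U = basis_proj m j"
proof (rule eq_matI)
  fix r s assume "r < dim_row (basis_proj m j)" "s < dim_col (basis_proj m j)"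
  then have rs: "r < m" "s < m" by simp_all
  have UP: "(U * basis_proj d i) $$ (r, k) = of_bool (r = j \<and> k = i)" if "k < d" for k
  proof -
    have "(U * basis_proj d i) $$ (r, k)
        = (\<Sum>l = 0..<d. if l = i then U $$ (r, i) * of_bool (k = i) else 0)"
      using U rs that by (auto simp: scalar_prod_def basis_proj_def intro!: sum.cong)
    also have "\<dots> = of_bool (r = j \<and> k = i)"
      using \<open>i < d\<close> col rs by simp
    finally show ?thesis .
  qed
  have "(U * basis_proj d i * mat_adjoint U) $$ (r, s)
      = (\<Sum>k = 0..<d. (U * basis_proj d i) $$ (r, k) * cnj (U $$ (s, k)))"
    using U rs by (simp add: scalar_prod_def)
  also have "\<dots> = (\<Sum>k = 0..<d. if k = i then of_bool (r = j) * cnj (U $$ (s, i)) else 0)"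
    using UP by (intro sum.cong) auto
  also have "\<dots> = of_bool (r = j \<and> s = j)"
    using \<open>i < d\<close> col rs by simp
  finally show "(U * basis_proj d i * mat_adjoint U) $$ (r, s) = basis_proj m j $$ (r, s)"
    using rs by (simp add: basis_proj_def)
qed (use U in simp_all)

lemma mult_add_less:
  fixes k :: nat
  assumes "k < a" "i < b"
  shows "k * b + i < a * b"
proof -
  have "k * b + i < Suc k * b" using assms by simp
  also have "\<dots> \<le> a * b" using assms by (intro mult_le_mono1) simp
  finally show ?thesis .
qed

lemma mult_add_eq_iff:
  fixes k :: nat
  assumes "i < b" "j < b"
  shows "k * b + i = l * b + j \<longleftrightarrow> k = l \<and> i = j"
  using div_mod_eq_iff[OF assms(2), of "k * b + i" l] assms(1) by simp

lemma partial_trace_fst_basis_proj: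
  assumes "i < a" "j < b"
  shows "partial_trace_fst a b (basis_proj (a * b) (i * b + j)) = basis_proj b j"
proof (rule eq_matI)
  fix r s assume "r < dim_row (basis_proj b j)" "s < dim_col (basis_proj b j)"
  then have rs: "r < b" "s < b" by simp_all
  then have "partial_trace_fst a b (basis_proj (a * b) (i * b + j)) $$ (r, s)
      = (\<Sum>k<a. if k = i then of_bool (r = j \<and> s = j) else 0)"
    using assms by (auto simp: partial_trace_fst_def basis_proj_def mult_add_less mult_add_eq_iff
        intro!: sum.cong)
  with assms rs show "partial_trace_fst a b (basis_proj (a * b) (i * b + j)) $$ (r, s)
      = basis_proj b j $$ (r, s)"
    by (simp add: basis_proj_def)
qed (simp_all add: partial_trace_fst_def)

lemma partial_trace_snd_basis_proj:
  assumes "i < a" "j < b"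
  shows "partial_trace_snd a b (basis_proj (a * b) (i * b + j)) = basis_proj a i"
proof (rule eq_matI)
  fix r s assume "r < dim_row (basis_proj a i)" "s < dim_col (basis_proj a i)"
  then have rs: "r < a" "s < a" by simp_all
  then have "partial_trace_snd a b (basis_proj (a * b) (i * b + j)) $$ (r, s)
      = (\<Sum>k<b. if k = j then of_bool (r = i \<and> s = i) else 0)"
    using assms by (auto simp: partial_trace_snd_def basis_proj_def mult_add_less mult_add_eq_iff
        intro!: sum.cong)
  with assms rs show "partial_trace_snd a b (basis_proj (a * b) (i * b + j)) $$ (r, s)
      = basis_proj a i $$ (r, s)"
    by (simp add: basis_proj_def)
qed (simp_all add: partial_trace_snd_def)

lemma prod_of_bool:
  "finite A \<Longrightarrow> (\<Prod>k\<in>A. of_bool (P k)) = (of_bool (\<forall>k\<in>A. P k) :: complex)"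
  by (induction A rule: finite_induct) auto

text \<open>An entry of the tensor power is a product of indicators that all digits of both indices
  vanish, and only the index 0 has all digits zero.\<close>

lemma tensor_power_basis_proj:
  assumes "0 < d"
  shows "tensor_power (basis_proj d 0) n = basis_proj (d ^ n) 0"
proof (rule eq_matI)
  fix r c assume "r < dim_row (basis_proj (d ^ n) 0)" "c < dim_col (basis_proj (d ^ n) 0)"
  then have rc: "r < d ^ n" "c < d ^ n" by simp_all
  have "0 < d ^ n" using assms by simp
  then have "(\<forall>k<n. digit d k r = 0 \<and> digit d k c = 0) \<longleftrightarrow> r = 0 \<and> c = 0"
    using digits_eqI[of r d n 0] digits_eqI[of c d n 0] rc by auto
  moreover have "tensor_power (basis_proj d 0) n $$ (r, c)
      = (\<Prod>k<n. of_bool (digit d k r = 0 \<and> digit d k c = 0))"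
    using rc assms by (simp add: tensor_power_def basis_proj_def digit_less)
  ultimately show "tensor_power (basis_proj d 0) n $$ (r, c) = basis_proj (d ^ n) 0 $$ (r, c)"
    using rc by (simp add: prod_of_bool basis_proj_def Ball_def)
qed (simp_all add: tensor_power_def)

lemma mat_trace_mult_basis_proj:
  assumes "A \<in> carrier_mat d d" "i < d"
  shows "mat_trace (A * basis_proj d i) = A $$ (i, i)"
proof -
  have "(A * basis_proj d i) $$ (r, r) = (if r = i then A $$ (i, i) else 0)" if "r < d" for r
  proof -
    have "(A * basis_proj d i) $$ (r, r)
        = (\<Sum>l = 0..<d. if l = i then (if r = i then A $$ (i, i) else 0) else 0)"
      using assms that by (auto simp: scalar_prod_def basis_proj_def intro!: sum.cong)
    then show ?thesis using assms by simp
  qed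
  then show ?thesis
    using assms by (simp add: mat_trace_def)
qed

section \<open>Trace norm of zero\<close>

lemma psd_mat_zero: "psd_mat d (0\<^sub>m d d)"
proof -
  have eq: "0\<^sub>m d d = mat d d (\<lambda>(r, c). if r = c then complex_of_real 0 else 0)"
    by (auto intro!: eq_matI)
  show ?thesis
    unfolding eq by (rule psd_diag[of d "\<lambda>_. 0"]) simp
qed

text \<open>As P is Hermitian, the i-th diagonal entry of P P is the squared norm of the i-th row,
  so every row vanishes.\<close>

lemma hermitian_square_zero:
  fixes P :: "complex mat"
  assumes "P \<in> carrier_mat d d" "mat_adjoint P = P" "P * P = 0\<^sub>m d d"
  shows "P = 0\<^sub>m d d"
proof (rule eq_matI)
  fix i k assume "i < dim_row (0\<^sub>m d d :: complex mat)" "k < dim_col (0\<^sub>m d d :: complex mat)"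
  then have ik: "i < d" "k < d" by simp_all
  have sym: "P $$ (l, i) = cnj (P $$ (i, l))" if "l < d" for l
    using assms(1,2) ik that by (metis carrier_matD index_mat_adjoint)
  have "0 = (P * P) $$ (i, i)"
    using assms(3) ik by simp
  also have "\<dots> = (\<Sum>l = 0..<d. P $$ (i, l) * cnj (P $$ (i, l)))"
    using assms(1) ik sym by (simp add: scalar_prod_def)
  also have "\<dots> = complex_of_real (\<Sum>l = 0..<d. (cmod (P $$ (i, l)))\<^sup>2)"
    by (simp only: of_real_sum complex_norm_square)
  finally have "(\<Sum>l = 0..<d. (cmod (P $$ (i, l)))\<^sup>2) = 0"
    by (metis of_real_eq_0_iff)
  then show "P $$ (i, k) = 0\<^sub>m d d $$ (i, k)"
    using ik by (subst (asm) sum_nonneg_eq_0_iff) auto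
qed (use assms in auto)

text \<open>\<open>psd_sqrt\<close> is a definite description, so its value at zero requires that
  zero has no other positive semidefinite root.\<close>

lemma trace_norm_zero [simp]: "trace_norm (0\<^sub>m d d) = 0"
proof -
  have "psd_sqrt (0\<^sub>m d d) = 0\<^sub>m d d"
    unfolding psd_sqrt_def
    by (rule the_equality) (auto simp: psd_mat_zero psd_mat_def[of d] intro!: hermitian_square_zero)
  moreover have "mat_adjoint (0\<^sub>m d d) * 0\<^sub>m d d = (0\<^sub>m d d :: complex mat)"
    by (rule right_mult_zero_mat) (auto simp: mat_adjoint_def)
  ultimately show ?thesis
    by (simp add: trace_norm_def mat_trace_def)
qed

section \<open>The parity channel on basis states\<close>

lemma phi0_eq: "phi0 = basis_proj 2 0"
  by (auto simp: phi0_def ket0_def basis_proj_def mat_of_rows_list_def scalar_prod_def less_2_cases_iff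
      intro!: eq_matI)

lemma less_8_cases:
  fixes c :: nat
  assumes "c < 8"
  shows "c = 0 \<or> c = 1 \<or> c = 2 \<or> c = 3 \<or> c = 4 \<or> c = 5 \<or> c = 6 \<or> c = 7"
  using assms by linarith

lemma dim_tensor_mat [simp]:
  "dim_row (A \<otimes>\<^sub>m B) = dim_row A * dim_row B" "dim_col (A \<otimes>\<^sub>m B) = dim_col A * dim_col B"
  by (simp_all add: tensor_mat_def)

lemma dim_pauli_Z [simp]: "dim_row pauli_Z = 2" "dim_col pauli_Z = 2"
  by (simp_all add: pauli_Z_def mat_of_rows_list_def)

lemma dim_ket [simp]:
  "dim_row ket0 = 2" "dim_col ket0 = 1" "dim_row ket1 = 2" "dim_col ket1 = 1"
  by (simp_all add: ket0_def ket1_def mat_of_rows_list_def)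

lemma dim_parity_V [simp]: "dim_row parity_V = 8" "dim_col parity_V = 8"
  by (simp_all add: parity_V_def)

lemma dim_Pi [simp]:
  "dim_row Pi_plus = 8" "dim_col Pi_plus = 8" "dim_row Pi_minus = 8" "dim_col Pi_minus = 8"
  by (simp_all add: Pi_plus_def Pi_minus_def)

lemma parity_W_carrier: "parity_W \<in> carrier_mat 16 8"
  by (rule carrier_matI) (simp_all add: parity_W_def)

lemma pauli_Z_index:
  "i < 2 \<Longrightarrow> j < 2 \<Longrightarrow> pauli_Z $$ (i, j) = (if i = j then (- 1) ^ i else 0)"
  by (auto simp: pauli_Z_def mat_of_rows_list_def less_2_cases_iff)

text \<open>The sign is -1 to the sum of the three bits of c. Modulo 2, the terms
  \<open>c div 4\<close>, \<open>c div 2\<close> and \<open>c\<close> are the high, middle and low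
  bit.\<close>

lemma parity_V_index:
  assumes "b < 8" "c < 8"
  shows "parity_V $$ (b, c) = (if b = c then (- 1) ^ (c div 4 + c div 2 + c) else 0)"
proof -
  have "parity_V $$ (b, c) = pauli_Z $$ (b div 4, c div 4)
      * (pauli_Z $$ (b mod 4 div 2, c mod 4 div 2) * pauli_Z $$ (b mod 4 mod 2, c mod 4 mod 2))"
    using assms by (simp add: parity_V_def tensor_mat_def)
  also have "\<dots> = (if b = c then (- 1) ^ (c div 4 + c div 2 + c) else 0)"
    using less_8_cases[OF assms(1)] less_8_cases[OF assms(2)]
    by (elim disjE) (simp_all add: pauli_Z_index)
  finally show ?thesis .
qed

text \<open>The projectors are diagonal with entries (1 + s)/2 and (1 - s)/2, where s is the sign of
  the parity; these are the indicators of even and odd parity. So W copies the basis vector to B and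
  writes its parity into E.\<close>

lemma parity_W_index:
  assumes "e < 2" "b < 8" "x < 2" "y < 2" "z < 2"
  shows "parity_W $$ (e * 8 + b, x * 4 + y * 2 + z)
    = of_bool (b = x * 4 + y * 2 + z \<and> e = (x + y + z) mod 2)"
proof -
  define c where "c = x * 4 + y * 2 + z"
  have c: "c < 8" using assms by (simp add: c_def)
  have sgn: "(- 1 :: complex) ^ (c div 4 + c div 2 + c) = (- 1) ^ (x + y + z)"
    using assms(3-5) by (auto simp: c_def less_2_cases_iff)
  have "parity_W $$ (e * 8 + b, c)
      = (of_bool (b = c) + (if e = 0 then 1 else - 1) * parity_V $$ (b, c)) / 2"
    using assms(1,2) c
    by (auto simp: parity_W_def tensor_mat_def Pi_plus_def Pi_minus_def ket0_def ket1_def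
        mat_of_rows_list_def less_2_cases_iff)
  also have "\<dots> = of_bool (b = c \<and> e = (x + y + z) mod 2)"
    unfolding parity_V_index[OF assms(2) c] sgn
    using assms(1,3-5) by (auto simp: less_2_cases_iff)
  finally show ?thesis unfolding c_def .
qed

lemma innocent_state:
  "innocent_warden_state 2 8 parity_W phi0 phi0 phi0 = basis_proj 2 0"
proof -
  have "parity_W * basis_proj 8 0 * mat_adjoint parity_W = basis_proj 16 0"
  proof (rule conj_basis_proj[OF parity_W_carrier])
    fix r :: nat assume "r < 16"
    then have "r div 8 < 2" by linarith
    then have "parity_W $$ (r div 8 * 8 + r mod 8, 0 * 4 + 0 * 2 + 0)
        = of_bool (r mod 8 = 0 \<and> r div 8 = 0)"
      by (subst parity_W_index) auto
    moreover have "r mod 8 = 0 \<and> r div 8 = 0 \<longleftrightarrow> r = 0" by auto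
    ultimately show "parity_W $$ (r, 0) = of_bool (r = 0)" by simp
  qed simp
  then show ?thesis
    using partial_trace_snd_basis_proj[of 0 2 0 8]
    by (simp add: innocent_warden_state_def phi0_eq tensor_basis_proj)
qed

section \<open>The code and the action of the n-fold isometry on its words\<close>

definition helper_word :: "nat \<Rightarrow> nat \<Rightarrow> nat \<Rightarrow> nat" where
  "helper_word n x y = of_digits 2 n (\<lambda>k. (digit 2 k x + digit 2 k y) mod 2)"

text \<open>The label of the receiver's basis vector: each base-8 symbol packs the three input bits
  of one channel use, with the bit of the first transmitter on top.\<close>

definition output_word :: "nat \<Rightarrow> nat \<Rightarrow> nat \<Rightarrow> nat" where
  "output_word n x y = of_digits 8 n
     (\<lambda>k. digit 2 k x * 4 + digit 2 k y * 2 + (digit 2 k x + digit 2 k y) mod 2)"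

lemma helper_word_less: "helper_word n x y < 2 ^ n"
  unfolding helper_word_def by (rule of_digits_less) simp

lemma output_symbol_less:
  "digit 2 k x * 4 + digit 2 k y * 2 + (digit 2 k x + digit 2 k y) mod 2 < 8"
  using digit_less[of 2 k x] digit_less[of 2 k y] by (auto simp: less_2_cases_iff)

lemma output_word_less: "output_word n x y < 8 ^ n"
  unfolding output_word_def by (rule of_digits_less) (rule output_symbol_less)

lemma digit_output_word:
  assumes "k < n"
  shows "digit 8 k (output_word n x y)
    = digit 2 k x * 4 + digit 2 k y * 2 + (digit 2 k x + digit 2 k y) mod 2"
  unfolding output_word_def by (rule digit_of_digits[OF output_symbol_less assms])

text \<open>The two upper bits of each symbol are the digits of x and y, so the received word
  determines both.\<close>

lemma output_word_inj:
  assumes "x < 2 ^ n" "y < 2 ^ n" "x' < 2 ^ n" "y' < 2 ^ n"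
    and "output_word n x y = output_word n x' y'"
  shows "x = x' \<and> y = y'"
proof -
  have eq: "digit 2 k x = digit 2 k x' \<and> digit 2 k y = digit 2 k y'" if "k < n" for k
    using digit_output_word[OF that, of x y] digit_output_word[OF that, of x' y'] assms(5)
      digit_less[of 2 k x] digit_less[of 2 k y] digit_less[of 2 k x'] digit_less[of 2 k y']
    by (auto simp: less_2_cases_iff)
  then show ?thesis
    using digits_eqI assms(1-4) by blast
qed

text \<open>The column is labelled by the joint input of x, y and the helper's word. Its entries are
  products of single-use entries, each the indicator that the warden's digit is 0 and the receiver's
  digit is the right symbol; together these fix the whole row index.\<close>

lemma isometry_power_column:
  assumes xy: "x < 2 ^ n" "y < 2 ^ n" and r: "r < 2 ^ n * 8 ^ n"
  shows "isometry_power 2 8 parity_W n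
      $$ (r, x * (2 ^ n * 2 ^ n) + (y * 2 ^ n + helper_word n x y))
    = of_bool (r = output_word n x y)"
proof -
  let ?h = "helper_word n x y" and ?o = "output_word n x y"
  let ?e = "r div 8 ^ n" and ?b = "r mod 8 ^ n"
  let ?c = "x * (2 ^ n * 2 ^ n) + (y * 2 ^ n + ?h)"
  have tail: "y * 2 ^ n + ?h < 2 ^ n * 2 ^ n"
    by (rule mult_add_less[OF xy(2) helper_word_less])
  have c: "?c < 2 ^ n * (2 ^ n * 2 ^ n)"
    by (rule mult_add_less[OF xy(1) tail])
  have c1: "?c div (2 ^ n * 2 ^ n) = x" using tail by simp
  \<comment> \<open>Regrouping x with y exposes the multiple of \<open>2 ^ n\<close>, from which
    quotient and remainder can be read off.\<close>
  have "?c = ?h + (x * 2 ^ n + y) * 2 ^ n" by (simp add: algebra_simps)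
  then have c2: "?c div 2 ^ n = x * 2 ^ n + y" and c3: "?c mod 2 ^ n = ?h"
    using helper_word_less[of n x y]
    by (simp_all only: div_mult_self1 mod_mult_self1 div_less mod_less power_not_zero) simp_all
  have e: "?e < 2 ^ n" using r by (simp add: less_mult_imp_div_less)
  have b: "?b < 8 ^ n" by simp
  \<comment> \<open>The warden's zero is written as a digit of 0, so that \<open>digits_eqI\<close>
    can later compare \<open>?e\<close> with 0.\<close>
  have entry: "parity_W $$ (digit 2 k ?e * 8 + digit 8 k ?b,
        digit 2 k x * (2 * 2) + digit 2 k y * 2 + digit 2 k ?h)
      = of_bool (digit 8 k ?b = digit 8 k ?o \<and> digit 2 k ?e = digit 2 k 0)" if "k < n" for k
  proof -
    have h: "digit 2 k ?h = (digit 2 k x + digit 2 k y) mod 2"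
      unfolding helper_word_def using that by (intro digit_of_digits) auto
    have "(digit 2 k x + digit 2 k y + (digit 2 k x + digit 2 k y) mod 2) mod 2 = 0"
      using digit_less[of 2 k x] digit_less[of 2 k y] by (auto simp: less_2_cases_iff)
    then show ?thesis
      using parity_W_index[of "digit 2 k ?e" "digit 8 k ?b" "digit 2 k x" "digit 2 k y" "digit 2 k ?h"]
      by (simp add: digit_less h digit_output_word[OF that])
  qed
  have "isometry_power 2 8 parity_W n $$ (r, ?c)
      = (\<Prod>k<n. parity_W $$ (digit 2 k ?e * 8 + digit 8 k ?b,
          digit 2 k x * (2 * 2) + digit 2 k y * 2 + digit 2 k ?h))"
    using r c xy(2) unfolding isometry_power_def Let_def
    by (simp only: index_mat c1 c2 c3 prod.case) simp
  also have "\<dots> = of_bool (\<forall>k<n. digit 8 k ?b = digit 8 k ?o \<and> digit 2 k ?e = digit 2 k 0)"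
    using entry by (simp add: prod_of_bool Ball_def)
  also have "(\<forall>k<n. digit 8 k ?b = digit 8 k ?o \<and> digit 2 k ?e = digit 2 k 0)
      \<longleftrightarrow> ?b = ?o \<and> ?e = 0"
    using digits_eqI[OF b output_word_less] digits_eqI[OF e, of 0] by auto
  also have "\<dots> \<longleftrightarrow> r = ?o"
    using div_mod_eq_iff[OF output_word_less, of r n 0 x y] by auto
  finally show ?thesis .
qed

text \<open>Messages start at 1 and basis labels at 0, hence the shift. The decoder measures in the
  standard basis and inverts the word map; outcomes that are no code word are assigned to the pair
  (1, 1), which makes the operators sum to the identity. The diagonal form matches
  \<open>psd_diag\<close>.\<close>

definition parity_code :: "nat \<Rightarrow> real \<Rightarrow> real \<Rightarrow> helper_code" where
  "parity_code n R1 R2 =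
    (let M = messages n R1 \<times> messages n R2; w = (\<lambda>(m1, m2). output_word n (m1 - 1) (m2 - 1)) in
     \<lparr>enc1 = (\<lambda>m. basis_proj (2 ^ n) (m - 1)),
      enc2 = (\<lambda>m. basis_proj (2 ^ n) (m - 1)),
      enc3 = (\<lambda>m1 m2. basis_proj (2 ^ n) (helper_word n (m1 - 1) (m2 - 1))),
      dec = (\<lambda>m. mat (8 ^ n) (8 ^ n) (\<lambda>(r, c). if r = c then complex_of_real (of_bool (
         (if r \<in> w ` M then inv_into M w r else (1, 1)) = m)) else 0))\<rparr>)"

text \<open>The rate bound enters here: there are at most \<open>2 ^ n\<close> messages, so each
  gets its own basis vector of n qubits.\<close>

lemma messages_bounds:
  assumes "R < 1" "m \<in> messages n R"
  shows "1 \<le> m" "m - 1 < 2 ^ n"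
proof -
  show "1 \<le> m" using assms(2) by (simp add: messages_def)
  have "2 powr (real n * R) \<le> 2 powr real n"
    using assms(1) by (intro powr_mono) (auto simp: mult_left_le)
  then have "2 powr (real n * R) \<le> 2 ^ n" by (simp add: powr_realpow)
  moreover have "real m \<le> 2 powr (real n * R)"
    using assms(2) by (auto simp: messages_def le_nat_iff le_floor_iff)
  ultimately have "real m \<le> 2 ^ n" by linarith
  then have "m \<le> 2 ^ n" by simp
  with \<open>1 \<le> m\<close> show "m - 1 < 2 ^ n" by linarith
qed

text \<open>Makes the decoder's default guess a legitimate message pair and the averages over
  messages run over nonempty sets.\<close>

lemma one_in_messages:
  assumes "0 \<le> R"
  shows "1 \<in> messages n R"
proof -
  have "1 \<le> 2 powr (real n * R)" using assms by (intro ge_one_powr_ge_zero) auto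
  then have "1 \<le> \<lfloor>2 powr (real n * R)\<rfloor>" by simp
  then show ?thesis by (simp add: messages_def Suc_le_eq)
qed

lemma finite_messages [simp]: "finite (messages n R)"
  by (simp add: messages_def)

section \<open>Error probability and covertness of the code\<close>

context
  fixes R1 R2 :: real
  assumes R1: "0 \<le> R1" "R1 < 1" and R2: "0 \<le> R2" "R2 < 1"
begin

lemma output_word_inj_on_messages:
  "inj_on (\<lambda>(m1, m2). output_word n (m1 - 1) (m2 - 1)) (messages n R1 \<times> messages n R2)"
proof (rule inj_onI, clarify)
  fix a b c d
  assume *: "a \<in> messages n R1" "b \<in> messages n R2" "c \<in> messages n R1" "d \<in> messages n R2"
    "output_word n (a - 1) (b - 1) = output_word n (c - 1) (d - 1)"
  then have "a - 1 = c - 1 \<and> b - 1 = d - 1"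
    using messages_bounds R1 R2 by (intro output_word_inj[of _ n]) blast+
  \<comment> \<open>Subtraction on naturals truncates, so recovering the messages from their shifts
    uses that they are at least 1.\<close>
  then show "a = c \<and> b = d"
    using messages_bounds(1) R1 R2 * by (metis le_add_diff_inverse)
qed

lemma is_helper_code_parity_code: "is_helper_code 8 R1 R2 n (parity_code n R1 R2)"
proof -
  let ?M = "messages n R1 \<times> messages n R2"
  let ?w = "\<lambda>(m1, m2). output_word n (m1 - 1) (m2 - 1)"
  let ?g = "\<lambda>r. if r \<in> ?w ` ?M then inv_into ?M ?w r else (1, 1)"
  \<comment> \<open>The decision map is total with values in the message set, so each outcome is
    counted by exactly one decoding operator and every diagonal entry of the sum is 1.\<close>
  have g: "?g r \<in> ?M" for r
    using one_in_messages R1 R2 inv_into_into[of r ?w ?M] by auto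
  have dec: "dec (parity_code n R1 R2) m = mat (8 ^ n) (8 ^ n)
      (\<lambda>(r, c). if r = c then complex_of_real (of_bool (?g r = m)) else 0)" for m
    by (simp only: parity_code_def Let_def helper_code.select_convs)
  have "psd_mat (8 ^ n) (dec (parity_code n R1 R2) m)" for m
    unfolding dec by (rule psd_diag) simp
  moreover have "mat (8 ^ n) (8 ^ n)
      (\<lambda>(r, c). \<Sum>m\<in>?M. dec (parity_code n R1 R2) m $$ (r, c)) = 1\<^sub>m (8 ^ n)"
  proof (rule eq_matI)
    fix r c assume "r < dim_row (1\<^sub>m (8 ^ n) :: complex mat)" "c < dim_col (1\<^sub>m (8 ^ n) :: complex mat)"
    then have rc: "r < 8 ^ n" "c < 8 ^ n" by simp_all
    have "(\<Sum>m\<in>?M. dec (parity_code n R1 R2) m $$ (r, c))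
        = (\<Sum>m\<in>?M. if ?g r = m then of_bool (r = c) else 0)"
      unfolding dec using rc by (intro sum.cong refl) auto
    also have "\<dots> = of_bool (r = c)"
      by (subst sum.delta') (use g[of r] in auto)
    finally show "mat (8 ^ n) (8 ^ n)
      (\<lambda>(r, c). \<Sum>m\<in>?M. dec (parity_code n R1 R2) m $$ (r, c)) $$ (r, c) = 1\<^sub>m (8 ^ n) $$ (r, c)"
      using rc by simp
  qed simp_all
  ultimately have "povm (8 ^ n) ?M (dec (parity_code n R1 R2))"
    by (simp add: povm_def)
  then show ?thesis
    using messages_bounds(2) R1 R2
    by (auto simp: is_helper_code_def parity_code_def Let_def helper_word_less
        intro!: density_basis_proj)
qed

lemma dec_parity_code_output:
  assumes "m1 \<in> messages n R1" "m2 \<in> messages n R2"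
  defines "b \<equiv> output_word n (m1 - 1) (m2 - 1)"
  shows "dec (parity_code n R1 R2) (m1, m2) $$ (b, b) = 1"
proof -
  let ?M = "messages n R1 \<times> messages n R2"
  let ?w = "\<lambda>(m1, m2). output_word n (m1 - 1) (m2 - 1)"
  have b: "b = ?w (m1, m2)" by (simp add: b_def)
  have "(m1, m2) \<in> ?M" using assms(1,2) by simp
  then have "b \<in> ?w ` ?M" "inv_into ?M ?w b = (m1, m2)"
    unfolding b using inv_into_f_f[OF output_word_inj_on_messages] by blast+
  moreover have "b < 8 ^ n" by (simp add: b_def output_word_less)
  ultimately show ?thesis by (simp add: parity_code_def Let_def)
qed

text \<open>The index keeps the summand \<open>0 * 8 ^ n\<close> to display the warden's label 0
  next to the receiver's word, in the shape that the partial trace lemmas expect.\<close>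

lemma channel_output_parity_code:
  assumes "m1 \<in> messages n R1" "m2 \<in> messages n R2"
  shows "channel_output 2 8 parity_W n (parity_code n R1 R2) m1 m2
    = basis_proj (2 ^ n * 8 ^ n) (0 * 8 ^ n + output_word n (m1 - 1) (m2 - 1))"
proof -
  let ?x = "m1 - 1" and ?y = "m2 - 1"
  let ?h = "helper_word n ?x ?y"
  have xy: "?x < 2 ^ n" "?y < 2 ^ n"
    using messages_bounds(2) assms R1 R2 by blast+
  have tail: "?y * 2 ^ n + ?h < 2 ^ n * 2 ^ n"
    by (rule mult_add_less[OF xy(2) helper_word_less])
  have c: "?x * (2 ^ n * 2 ^ n) + (?y * 2 ^ n + ?h) < 2 ^ n * (2 ^ n * 2 ^ n)"
    by (rule mult_add_less[OF xy(1) tail])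
  have U: "isometry_power 2 8 parity_W n \<in> carrier_mat (2 ^ n * 8 ^ n) (2 ^ n * (2 ^ n * 2 ^ n))"
    by (simp add: isometry_power_def)
  have "isometry_power 2 8 parity_W n
      * basis_proj (2 ^ n * (2 ^ n * 2 ^ n)) (?x * (2 ^ n * 2 ^ n) + (?y * 2 ^ n + ?h))
      * mat_adjoint (isometry_power 2 8 parity_W n)
    = basis_proj (2 ^ n * 8 ^ n) (output_word n ?x ?y)"
    by (rule conj_basis_proj[OF U c isometry_power_column[OF xy]])
  then show ?thesis
    by (simp add: channel_output_def parity_code_def Let_def
        tensor_basis_proj[OF helper_word_less] tensor_basis_proj[OF tail] del: One_nat_def)
qed

text \<open>The receiver holds the projector on the output word, so the success probability is a
  diagonal entry of the decoding operator, which is 1 at that word.\<close>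

lemma average_error_parity_code:
  "average_error 2 8 parity_W R1 R2 n (parity_code n R1 R2) = 0"
proof -
  have "mat_trace (dec (parity_code n R1 R2) (m1, m2)
      * receiver_state 2 8 parity_W n (parity_code n R1 R2) m1 m2) = 1"
    if "m1 \<in> messages n R1" "m2 \<in> messages n R2" for m1 m2
  proof -
    have "dec (parity_code n R1 R2) (m1, m2) \<in> carrier_mat (8 ^ n) (8 ^ n)"
      by (simp add: parity_code_def Let_def)
    then show ?thesis
      unfolding receiver_state_def channel_output_parity_code[OF that]
      by (subst partial_trace_fst_basis_proj)
        (simp_all add: output_word_less mat_trace_mult_basis_proj dec_parity_code_output[OF that]
          del: One_nat_def)
  qed
  then show ?thesis by (simp add: average_error_def)
qed

lemma average_warden_state_parity_code:
  "average_warden_state 2 8 parity_W R1 R2 n (parity_code n R1 R2) = basis_proj (2 ^ n) 0"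
proof (rule eq_matI)
  fix i j assume "i < dim_row (basis_proj (2 ^ n) 0)" "j < dim_col (basis_proj (2 ^ n) 0)"
  then have ij: "i < 2 ^ n" "j < 2 ^ n" by simp_all
  have "warden_state 2 8 parity_W n (parity_code n R1 R2) m1 m2 = basis_proj (2 ^ n) 0"
    if "m1 \<in> messages n R1" "m2 \<in> messages n R2" for m1 m2
    unfolding warden_state_def channel_output_parity_code[OF that]
    by (rule partial_trace_snd_basis_proj) (simp_all add: output_word_less)
  \<comment> \<open>Averaging a constant returns that constant only if the denominator is
    nonzero.\<close>
  moreover have "card (messages n R1) \<noteq> 0" "card (messages n R2) \<noteq> 0"
    using one_in_messages R1 R2 by (metis card_0_eq empty_iff finite_messages)+
  ultimately show "average_warden_state 2 8 parity_W R1 R2 n (parity_code n R1 R2) $$ (i, j)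
      = basis_proj (2 ^ n) 0 $$ (i, j)"
    using ij by (simp add: average_warden_state_def)
qed (simp_all add: average_warden_state_def)

lemma covertly_achievable_parity:
  "covertly_achievable 2 8 parity_W phi0 phi0 phi0 (R1, R2)"
proof -
  \<comment> \<open>The averaged warden state and the power of the innocent state are the same
    projector, so the trace norm is 0 for every n, not only in the limit.\<close>
  have "trace_norm (basis_proj d i - basis_proj d i) = 0" for d i
    by (simp add: minus_r_inv_mat[of _ d d])
  then show ?thesis
    unfolding covertly_achievable_def prod.case
    using R1 R2 is_helper_code_parity_code
    by (intro conjI exI[of _ "\<lambda>n. parity_code n R1 R2"])
      (simp_all add: average_error_parity_code average_warden_state_parity_code innocent_state
        tensor_power_basis_proj)
qed

end

theorem corollary7:
  shows "{(R1 :: real, R2 :: real). 0 \<le> R1 \<and> R1 < 1 \<and> 0 \<le> R2 \<and> R2 < 1}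
           \<subseteq> covert_capacity_region 2 8 parity_W phi0 phi0 phi0"
  unfolding covert_capacity_region_def
  using covertly_achievable_parity closure_subset by fast

end
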